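(* Let $\beta$ be a unit-speed timelike curve in $\mathbb{E}^4_1$ with Frenet frame $\{F_1,F_2,F_3,F_4\}$, let $r>0$ be constant, and let $M$ be the tubular hypersurface $$\mathcal{T}(s,t,w)=\beta(s)+r(\cos t\cos w\,F_2(s)+\sin t\cos w\,F_3(s)+\sin w\,F_4(s))$$ in $\mathbb{E}^4_1$, with Gauss map $N=-(\cos t\cos w\,F_2+\sin t\cos w\,F_3+\sin w\,F_4)$. Then $M$ does not have first kind $\mathcal{L}_2$-pointwise 1-type Gauss map; that is, there does not exist a non-zero smooth function $\mathfrak{m}$ on $M$ such that $\mathcal{L}_2N=\mathfrak{m}N$.
   Context: $\mathbb{E}^4_1$ is $\mathbb{R}^4$ with the metric $\langle\ ,\ \rangle=-dx_1^2+dx_2^2+dx_3^2+dx_4^2$. The curve $\beta:I\to\mathbb{E}^4_1$ ($I$ an open interval) is smooth with $\beta'=F_1$, and $\{F_1,F_2,F_3,F_4\}$ is a smooth orthonormal frame along $\beta$ with $\langle F_1,F_1\rangle=-1$, $\langle F_i,F_i\rangle=1$ ($i=2,3,4$), satisfying the Frenet equations $F_1'=k_1F_2$, $F_2'=k_1F_1+k_2F_3$, $F_3'=-k_2F_2+k_3F_4$, $F_4'=-k_3F_3$, where $k_1,k_2,k_3$ are smooth functions of $s$ (the curvatures of $\beta$). The parameters $(s,t,w)$ range over a connected open set $U\subset I\times\mathbb{R}^2$ projecting onto $I$ on which $\mathcal{T}$ is an immersion, i.e. $\cos w\neq0$ and $1+rk_1\cos t\cos w\neq0$. The unit normal $N$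 has $\varepsilon=\langle N,N\rangle=1$, and the principal curvatures with respect to $N$ (eigenvalues of the shape operator $-dN$) are $\kappa_1=\kappa_2=\frac1r$, $\kappa_3=\frac{k_1\cos t\cos w}{1+rk_1\cos t\cos w}$. Operator $\mathcal{L}_2$ on the Gauss map: put $a_1=-\sum_i\kappa_i$, $a_k=(-1)^k\sum_{i_1<\dots<i_k}\kappa_{i_1}\cdots\kappa_{i_k}$ ($k=2,3$), and define $H_k$ by $\binom{3}{k}H_k=(-\varepsilon)^ka_k$. Then $$\mathcal{L}_2N=-\varepsilon\,\mathfrak{C}_2\big(\nabla H_3+3H_1H_3\,N\big),\qquad \mathfrak{C}_2=\binom33(-\varepsilon)^2=1,$$ where $\nabla$ is the gradient on $M$ with respect to the induced metric, viewed as an $\mathbb{E}^4_1$-valued map. "Non-zero function" means not identically zero. *)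

theory Defs
  imports "HOL-Analysis.Analysis"
begin

primrec Ck_on :: "nat \<Rightarrow> 'a::real_normed_vector set \<Rightarrow> ('a \<Rightarrow> 'b::real_normed_vector) \<Rightarrow> bool"
  where
    "Ck_on 0 S f \<longleftrightarrow> continuous_on S f"
  | "Ck_on (Suc n) S f \<longleftrightarrow>
       (\<forall>x\<in>S. f differentiable (at x)) \<and>
       (\<forall>v. Ck_on n S (\<lambda>x. frechet_derivative f (at x) v))"

text \<open>Intended for open sets only, since derivatives are taken in the full space.\<close>

definition smooth_on :: "'a::real_normed_vector set \<Rightarrow> ('a \<Rightarrow> 'b::real_normed_vector) \<Rightarrow> bool"
  where "smooth_on S f \<longleftrightarrow> (\<forall>n. Ck_on n S f)"

definition lorentz :: "real^4 \<Rightarrow> real^4 \<Rightarrow> real"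
  where "lorentz x y = - (x$1 * y$1) + x$2 * y$2 + x$3 * y$3 + x$4 * y$4"

text \<open>Frames are indexed by the four-element type \<open>4\<close>, in which \<open>4 = 0\<close>;
  the first vector is the timelike one.\<close>

definition timelike_frenet_curve ::
    "real set \<Rightarrow> (real \<Rightarrow> real^4) \<Rightarrow> (4 \<Rightarrow> real \<Rightarrow> real^4) \<Rightarrow>
     (real \<Rightarrow> real) \<Rightarrow> (real \<Rightarrow> real) \<Rightarrow> (real \<Rightarrow> real) \<Rightarrow> bool"
  where "timelike_frenet_curve I \<beta> F k1 k2 k3 \<longleftrightarrow>
    smooth_on I \<beta> \<and> (\<forall>i. smooth_on I (F i)) \<and>
    smooth_on I k1 \<and> smooth_on I k2 \<and> smooth_on I k3 \<and>
    (\<forall>s\<in>I.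
      (\<forall>i j. lorentz (F i s) (F j s) = (if i \<noteq> j then 0 else if i = 1 then - 1 else 1)) \<and>
      (\<beta> has_vector_derivative F 1 s) (at s) \<and>
      (F 1 has_vector_derivative k1 s *\<^sub>R F 2 s) (at s) \<and>
      (F 2 has_vector_derivative (k1 s *\<^sub>R F 1 s + k2 s *\<^sub>R F 3 s)) (at s) \<and>
      (F 3 has_vector_derivative (- k2 s *\<^sub>R F 2 s + k3 s *\<^sub>R F 4 s)) (at s) \<and>
      (F 4 has_vector_derivative (- k3 s *\<^sub>R F 3 s)) (at s))"

text \<open>Hypersurfaces are given by a parametrization \<open>X\<close> on an open subset of
  \<open>real^3\<close>, with a unit normal \<open>N\<close> depending on the parameters. Functions on the
  hypersurface are functions of the parameters.\<close>

definition immersion_on :: "(real^3) set \<Rightarrow> (real^3 \<Rightarrow> real^4) \<Rightarrow> bool"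
  where "immersion_on U X \<longleftrightarrow>
    smooth_on U X \<and> (\<forall>p\<in>U. inj (frechet_derivative X (at p)))"

text \<open>The shape operator \<open>- dN\<close>, transported from the tangent space (the range of
  \<open>dX\<close>) to the parameter space by means of the isomorphism \<open>dX\<close>; it is thus the
  matrix of the shape operator in the basis of the coordinate vector fields.\<close>

definition shape_operator :: "(real^3 \<Rightarrow> real^4) \<Rightarrow> (real^3 \<Rightarrow> real^4) \<Rightarrow> real^3 \<Rightarrow> real^3^3"
  where "shape_operator X N p =
    (THE A. \<forall>v. frechet_derivative X (at p) (A *v v) = - frechet_derivative N (at p) v)"

text \<open>The eigenvalues of the shape operator, with algebraic multiplicity. Their order is
  arbitrary; only symmetric functions of them are used.\<close>

definition principal_curvatures :: "(real^3 \<Rightarrow> real^4) \<Rightarrow> (real^3 \<Rightarrow> real^4) \<Rightarrow> real^3 \<Rightarrow> real^3"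
  where "principal_curvatures X N p =
    (SOME \<kappa>. \<forall>x. det (mat x - shape_operator X N p) = (\<Prod>i\<in>UNIV. x - \<kappa> $ i))"

definition curv_coeff :: "(real^3 \<Rightarrow> real^4) \<Rightarrow> (real^3 \<Rightarrow> real^4) \<Rightarrow> nat \<Rightarrow> real^3 \<Rightarrow> real"
  where "curv_coeff X N k p =
    (- 1) ^ k * (\<Sum>J | J \<subseteq> (UNIV :: 3 set) \<and> card J = k.
                    \<Prod>i\<in>J. principal_curvatures X N p $ i)"

definition normal_sign :: "(real^3 \<Rightarrow> real^4) \<Rightarrow> real^3 \<Rightarrow> real"
  where "normal_sign N p = lorentz (N p) (N p)"

definition mean_curv :: "(real^3 \<Rightarrow> real^4) \<Rightarrow> (real^3 \<Rightarrow> real^4) \<Rightarrow> nat \<Rightarrow> real^3 \<Rightarrow> real"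
  where "mean_curv X N k p =
    (- normal_sign N p) ^ k * curv_coeff X N k p / real (3 choose k)"

text \<open>The gradient for the induced metric: the tangent vector representing \<open>df\<close>.\<close>

definition surface_grad :: "(real^3 \<Rightarrow> real^4) \<Rightarrow> (real^3 \<Rightarrow> real) \<Rightarrow> real^3 \<Rightarrow> real^4"
  where "surface_grad X f p =
    (THE v. v \<in> range (frechet_derivative X (at p)) \<and>
       (\<forall>u. lorentz v (frechet_derivative X (at p) u) = frechet_derivative f (at p) u))"

definition L2_gauss :: "(real^3 \<Rightarrow> real^4) \<Rightarrow> (real^3 \<Rightarrow> real^4) \<Rightarrow> real^3 \<Rightarrow> real^4"
  where "L2_gauss X N p =
    (- normal_sign N p * (real (3 choose 3) * (- normal_sign N p)\<^sup>2)) *\<^sub>R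
      (surface_grad X (mean_curv X N 3) p
        + (3 * mean_curv X N 1 p * mean_curv X N 3 p) *\<^sub>R N p)"

definition first_kind_L2_pointwise_1_type ::
    "(real^3) set \<Rightarrow> (real^3 \<Rightarrow> real^4) \<Rightarrow> (real^3 \<Rightarrow> real^4) \<Rightarrow> bool"
  where "first_kind_L2_pointwise_1_type U X N \<longleftrightarrow>
    (\<exists>m :: real^3 \<Rightarrow> real. smooth_on U m \<and> (\<exists>p\<in>U. m p \<noteq> 0) \<and>
       (\<forall>p\<in>U. L2_gauss X N p = m p *\<^sub>R N p))"

text \<open>The parameters \<open>(s, t, w)\<close> are the components of a vector in \<open>real^3\<close>.\<close>

definition tube_gauss :: "(4 \<Rightarrow> real \<Rightarrow> real^4) \<Rightarrow> real^3 \<Rightarrow> real^4"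
  where "tube_gauss F p =
    - ((cos (p$2) * cos (p$3)) *\<^sub>R F 2 (p$1) + (sin (p$2) * cos (p$3)) *\<^sub>R F 3 (p$1)
        + sin (p$3) *\<^sub>R F 4 (p$1))"

definition tube :: "(real \<Rightarrow> real^4) \<Rightarrow> (4 \<Rightarrow> real \<Rightarrow> real^4) \<Rightarrow> real \<Rightarrow> real^3 \<Rightarrow> real^4"
  where "tube \<beta> F r p =
    \<beta> (p$1) + r *\<^sub>R ((cos (p$2) * cos (p$3)) *\<^sub>R F 2 (p$1)
        + (sin (p$2) * cos (p$3)) *\<^sub>R F 3 (p$1) + sin (p$3) *\<^sub>R F 4 (p$1))"

end

theory Submission imports Defs begin

text \<open>The tangent space of the tube at \<open>(s, t, w)\<close> is spanned by the orthogonal vectors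
  \<open>F\<^sub>1\<close>, \<open>n\<^sub>t\<close>, \<open>n\<^sub>w\<close>, where \<open>n = - N\<close>. In terms of them the shape operator is
  triangular, with diagonal \<open>g / (1 + r g), 1 / r, 1 / r\<close> for \<open>g = k\<^sub>1 cos t cos w\<close>; so
  \<open>H\<^sub>3 = g / (r\<^sup>2 (1 + r g))\<close>. If \<open>\<L>\<^sub>2 N\<close> is a multiple of \<open>N\<close>, then the tangential
  vector \<open>\<nabla> H\<^sub>3\<close> vanishes. Its \<open>t\<close>-component gives \<open>k\<^sub>1 sin t = 0\<close> on an open set, hence
  \<open>k\<^sub>1 = 0\<close>. But then \<open>H\<^sub>3 = 0\<close> and \<open>\<L>\<^sub>2 N = 0\<close>, which forces the factor to vanish.\<close>

section \<open>Lorentz product, and derivatives of functions of one coordinate\<close>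

lemma lorentz_add_left: "lorentz (x + y) z = lorentz x z + lorentz y z"
  and lorentz_add_right: "lorentz z (x + y) = lorentz z x + lorentz z y"
  and lorentz_diff_left: "lorentz (x - y) z = lorentz x z - lorentz y z"
  and lorentz_diff_right: "lorentz z (x - y) = lorentz z x - lorentz z y"
  and lorentz_minus_left: "lorentz (- x) z = - lorentz x z"
  and lorentz_minus_right: "lorentz z (- x) = - lorentz z x"
  and lorentz_scaleR_left: "lorentz (c *\<^sub>R x) z = c * lorentz x z"
  and lorentz_scaleR_right: "lorentz z (c *\<^sub>R x) = c * lorentz z x"
  and lorentz_zero_left: "lorentz 0 z = 0"
  and lorentz_zero_right: "lorentz z 0 = 0"
  by (simp_all add: lorentz_def algebra_simps)

lemmas lorentz_linear = lorentz_add_left lorentz_add_right lorentz_diff_left lorentz_diff_right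
  lorentz_minus_left lorentz_minus_right lorentz_scaleR_left lorentz_scaleR_right
  lorentz_zero_left lorentz_zero_right

lemma smooth_on_imp_differentiable:
  "smooth_on S f \<Longrightarrow> x \<in> S \<Longrightarrow> f differentiable (at x)"
  unfolding smooth_on_def by (drule spec[of _ "Suc 0"]) simp

lemma prod_UNIV_3: "prod f (UNIV :: 3 set) = f 1 * f 2 * f 3"
  unfolding UNIV_3 by (simp add: ac_simps)

lemma sin_times_sin: "sin x * sin x = 1 - cos x * cos (x :: real)"
  using sin_cos_squared_add[of x] by (simp add: power2_eq_square)

lemma has_derivative_vec_nth: "((\<lambda>q. q $ i) has_derivative (\<lambda>u. u $ i)) (at p)"
  by (rule bounded_linear.has_derivative[OF bounded_linear_vec_nth has_derivative_ident])

lemma has_derivative_lift_component: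
  assumes "(f has_vector_derivative f') (at (p $ i))"
  shows "((\<lambda>q. f (q $ i)) has_derivative (\<lambda>u. u $ i *\<^sub>R f')) (at p)"
  using has_derivative_compose[OF has_derivative_vec_nth assms[unfolded has_vector_derivative_def]] .

lemma has_derivative_component_real:
  assumes "(f has_real_derivative f') (at (p $ i))"
  shows "((\<lambda>q. f (q $ i)) has_derivative (\<lambda>u. u $ i * f')) (at p)"
  using has_derivative_lift_component[of f f' p i] assms
  by (simp add: has_real_derivative_iff_has_vector_derivative)

section \<open>Adapted frame and differentials of the tube and its Gauss map\<close>

locale tube_of_frenet_curve =
  fixes I :: "real set" and \<beta> :: "real \<Rightarrow> real^4" and F :: "4 \<Rightarrow> real \<Rightarrow> real^4"
    and k1 k2 k3 :: "real \<Rightarrow> real" and r :: real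
  assumes frenet: "timelike_frenet_curve I \<beta> F k1 k2 k3"
    and r_pos: "r > 0"
begin

definition n_t :: "real^3 \<Rightarrow> real^4" where
  "n_t p = (- (sin (p$2) * cos (p$3))) *\<^sub>R F 2 (p$1) + (cos (p$2) * cos (p$3)) *\<^sub>R F 3 (p$1)"

definition n_w :: "real^3 \<Rightarrow> real^4" where
  "n_w p = (- (cos (p$2) * sin (p$3))) *\<^sub>R F 2 (p$1)
     + (- (sin (p$2) * sin (p$3))) *\<^sub>R F 3 (p$1) + cos (p$3) *\<^sub>R F 4 (p$1)"

definition g :: "real^3 \<Rightarrow> real" where
  "g p = k1 (p$1) * cos (p$2) * cos (p$3)"

text \<open>\<open>a n\<^sub>t + b n\<^sub>w\<close> is the part of \<open>\<partial>n/\<partial>s\<close> orthogonal to \<open>F\<^sub>1\<close>.\<close>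

definition a :: "real^3 \<Rightarrow> real" where
  "a p = k2 (p$1) - k3 (p$1) * cos (p$2) * sin (p$3) / cos (p$3)"

definition b :: "real^3 \<Rightarrow> real" where
  "b p = k3 (p$1) * sin (p$2)"

text \<open>The s-derivative of n by the Frenet equations. Unlike its expansion through
  \<open>a\<close>, this form is correct also where cos w = 0, a case that
  \<open>regular_point\<close> has to exclude.\<close>

definition n_s :: "real^3 \<Rightarrow> real^4" where
  "n_s p = (cos (p$2) * cos (p$3)) *\<^sub>R (k1 (p$1) *\<^sub>R F 1 (p$1) + k2 (p$1) *\<^sub>R F 3 (p$1))
     + (sin (p$2) * cos (p$3)) *\<^sub>R (- k2 (p$1) *\<^sub>R F 2 (p$1) + k3 (p$1) *\<^sub>R F 4 (p$1))
     + sin (p$3) *\<^sub>R (- k3 (p$1) *\<^sub>R F 3 (p$1))"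

text \<open>Only \<open>n_w\<close> has an \<open>F 4\<close>-part, which yields \<open>b\<close>;
  matching the \<open>F 2\<close>-parts then yields \<open>a\<close>, with its division by cos w.
  The \<open>F 3\<close>-parts agree by sin^2 t + cos^2 t = 1.\<close>

lemma n_s_eq:
  assumes "cos (p$3) \<noteq> 0"
  shows "n_s p = g p *\<^sub>R F 1 (p$1) + a p *\<^sub>R n_t p + b p *\<^sub>R n_w p"
proof -
  note 1 = sin_times_sin[of "p$2"]
  have "n_s p $ i = (g p *\<^sub>R F 1 (p$1) + a p *\<^sub>R n_t p + b p *\<^sub>R n_w p) $ i" for i
    unfolding n_s_def g_def a_def b_def n_t_def n_w_def
    apply (simp add: field_simps assms)
    using 1 by algebra
  then show ?thesis by (simp add: vec_eq_iff)
qed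

lemma frame_products:
  assumes "s \<in> I"
  shows "lorentz (F i s) (F j s) = (if i \<noteq> j then 0 else if i = 1 then - 1 else 1)"
  using frenet assms by (simp add: timelike_frenet_curve_def)

text \<open>The three vectors are mutually orthogonal with squares -1, cos^2 w and 1. The form is
  thus indefinite, but nondegenerate where cos w is nonzero.\<close>

lemma lorentz_tangent:
  assumes "p $ 1 \<in> I"
  shows "lorentz (x *\<^sub>R F 1 (p$1) + y *\<^sub>R n_t p + z *\<^sub>R n_w p)
           (x' *\<^sub>R F 1 (p$1) + y' *\<^sub>R n_t p + z' *\<^sub>R n_w p)
         = - (x * x') + y * y' * (cos (p$3))\<^sup>2 + z * z'"
proof -
  note 1 = sin_times_sin[of "p$2"] sin_times_sin[of "p$3"]
  show ?thesis
    unfolding n_t_def n_w_def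
    apply (simp add: lorentz_linear frame_products[OF assms] power2_eq_square)
    using 1 by algebra
qed

lemma lorentz_normal_tangent:
  assumes "p $ 1 \<in> I"
  shows "lorentz (tube_gauss F p) (x *\<^sub>R F 1 (p$1) + y *\<^sub>R n_t p + z *\<^sub>R n_w p) = 0"
proof -
  note 1 = sin_times_sin[of "p$2"]
  show ?thesis
    unfolding n_t_def n_w_def tube_gauss_def
    apply (simp add: lorentz_linear frame_products[OF assms])
    using 1 by algebra
qed

lemma lorentz_normal_normal:
  assumes "p $ 1 \<in> I"
  shows "lorentz (tube_gauss F p) (tube_gauss F p) = 1"
proof -
  note 1 = sin_times_sin[of "p$2"] sin_times_sin[of "p$3"]
  show ?thesis
    unfolding tube_gauss_def
    apply (simp add: lorentz_linear frame_products[OF assms])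
    using 1 by algebra
qed

lemma tube_gauss_has_derivative:
  assumes "p $ 1 \<in> I"
  shows "(tube_gauss F has_derivative
     (\<lambda>u. - (u$1 *\<^sub>R n_s p + u$2 *\<^sub>R n_t p + u$3 *\<^sub>R n_w p))) (at p)"
proof -
  have F: "((\<lambda>q. F 2 (q$1)) has_derivative
        (\<lambda>u. u$1 *\<^sub>R (k1 (p$1) *\<^sub>R F 1 (p$1) + k2 (p$1) *\<^sub>R F 3 (p$1)))) (at p)"
    "((\<lambda>q. F 3 (q$1)) has_derivative
        (\<lambda>u. u$1 *\<^sub>R (- k2 (p$1) *\<^sub>R F 2 (p$1) + k3 (p$1) *\<^sub>R F 4 (p$1)))) (at p)"
    "((\<lambda>q. F 4 (q$1)) has_derivative (\<lambda>u. u$1 *\<^sub>R (- k3 (p$1) *\<^sub>R F 3 (p$1)))) (at p)"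
    by (rule has_derivative_lift_component,
        use frenet assms in \<open>simp add: timelike_frenet_curve_def\<close>)+
  show ?thesis
    unfolding tube_gauss_def[abs_def]
    by (rule derivative_eq_intros has_derivative_vec_nth F refl)+
       (simp add: fun_eq_iff n_s_def n_t_def n_w_def algebra_simps)
qed

lemma tube_eq: "tube \<beta> F r p = \<beta> (p$1) - r *\<^sub>R tube_gauss F p"
  by (simp add: tube_def tube_gauss_def algebra_simps)

lemma tube_has_derivative:
  assumes "p $ 1 \<in> I"
  shows "(tube \<beta> F r has_derivative
     (\<lambda>u. u$1 *\<^sub>R F 1 (p$1) + r *\<^sub>R (u$1 *\<^sub>R n_s p + u$2 *\<^sub>R n_t p + u$3 *\<^sub>R n_w p))) (at p)"
proof -
  have "((\<lambda>q. \<beta> (q$1)) has_derivative (\<lambda>u. u$1 *\<^sub>R F 1 (p$1))) (at p)"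
    by (rule has_derivative_lift_component)
      (use frenet assms in \<open>simp add: timelike_frenet_curve_def\<close>)
  note 1 = has_derivative_diff[OF this has_derivative_scaleR_right[of _ _ _ r, OF
    tube_gauss_has_derivative[OF assms]]]
  show ?thesis
    unfolding tube_eq[abs_def] using 1 by (simp add: algebra_simps)
qed

lemmas frechet_tube = frechet_derivative_at[OF tube_has_derivative, symmetric]
lemmas frechet_gauss = frechet_derivative_at[OF tube_gauss_has_derivative, symmetric]

text \<open>In this frame the \<open>n_t\<close>- and \<open>n_w\<close>-coefficients are those of
  the Gauss map up to the factor \<open>- r\<close>, so the equation of the shape operator can be
  solved coefficient by coefficient.\<close>

lemma frechet_tube_frame:
  assumes "p $ 1 \<in> I" "cos (p$3) \<noteq> 0"
  shows "frechet_derivative (tube \<beta> F r) (at p) u =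
    (u$1 * (1 + r * g p)) *\<^sub>R F 1 (p$1) + (r * (a p * u$1 + u$2)) *\<^sub>R n_t p
      + (r * (b p * u$1 + u$3)) *\<^sub>R n_w p"
  by (simp add: frechet_tube[OF assms(1)] n_s_eq[OF assms(2)] algebra_simps)

lemma frechet_gauss_frame:
  assumes "p $ 1 \<in> I" "cos (p$3) \<noteq> 0"
  shows "frechet_derivative (tube_gauss F) (at p) u =
    - ((g p * u$1) *\<^sub>R F 1 (p$1) + (a p * u$1 + u$2) *\<^sub>R n_t p + (b p * u$1 + u$3) *\<^sub>R n_w p)"
  by (simp add: frechet_gauss[OF assms(1)] n_s_eq[OF assms(2)] algebra_simps)

section \<open>Regular points, curvatures and gradients\<close>

lemma regular_point:
  assumes p: "p $ 1 \<in> I" and inj: "inj (frechet_derivative (tube \<beta> F r) (at p))"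
  shows "cos (p$3) \<noteq> 0" and "1 + r * g p \<noteq> 0"
proof -
  have zero: "frechet_derivative (tube \<beta> F r) (at p) 0 = 0"
    by (simp add: frechet_tube[OF p])
  show c: "cos (p$3) \<noteq> 0"
  proof
    assume "cos (p$3) = 0"
    \<comment> \<open>Here \<open>n_t\<close> vanishes, so the t-direction lies in the
      kernel.\<close>
    then have "frechet_derivative (tube \<beta> F r) (at p) (axis 2 1) = 0"
      by (simp add: frechet_tube[OF p] n_t_def axis_def)
    then have "axis 2 1 = (0 :: real^3)"
      using inj zero by (metis injD)
    then show False by (simp add: axis_eq_0_iff)
  qed
  show "1 + r * g p \<noteq> 0"
  proof
    assume 0: "1 + r * g p = 0"
    \<comment> \<open>The entries \<open>- a p\<close> and \<open>- b p\<close> cancel the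
      \<open>n_t\<close>- and \<open>n_w\<close>-parts; what remains is \<open>1 + r * g p\<close>
      times \<open>F 1\<close>.\<close>
    let ?u = "vector [1, - a p, - b p] :: real^3"
    have "frechet_derivative (tube \<beta> F r) (at p) ?u = 0"
      using 0 by (simp add: frechet_tube_frame[OF p c])
    then have "?u = 0"
      using inj zero by (metis injD)
    then have "?u $ 1 = 0" by (simp only: zero_index)
    then show False by simp
  qed
qed

text \<open>The \<open>F 1\<close>-coefficient gives the first row. Substituting it into the other
  two leaves 1/r on the diagonal and the defect \<open>d\<close> in the first column. Injectivity of
  the differential makes the solution unique.\<close>

lemma shape_operator_tube:
  assumes p: "p $ 1 \<in> I" and inj: "inj (frechet_derivative (tube \<beta> F r) (at p))"
  defines "d \<equiv> 1 / r - g p / (1 + r * g p)"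
  shows "shape_operator (tube \<beta> F r) (tube_gauss F) p =
    vector [vector [g p / (1 + r * g p), 0, 0],
            vector [a p * d, 1 / r, 0],
            vector [b p * d, 0, 1 / r]]" (is "_ = ?A")
proof -
  note reg = regular_point[OF p inj]
  have A: "frechet_derivative (tube \<beta> F r) (at p) (?A *v u) =
      - frechet_derivative (tube_gauss F) (at p) u" for u
  proof -
    define c where "c = g p / (1 + r * g p)"
    have c: "c * (1 + r * g p) = g p" using reg by (simp add: c_def)
    have d: "r * d = 1 - r * c" using r_pos by (simp add: d_def c_def right_diff_distrib)
    have Au: "(?A *v u) $ 1 = c * u$1" "(?A *v u) $ 2 = a p * d * u$1 + u$2 / r"
      "(?A *v u) $ 3 = b p * d * u$1 + u$3 / r"
      by (simp_all add: matrix_vector_mult_def sum_3 c_def)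
    have A1: "(?A *v u) $ 1 * (1 + r * g p) = g p * u$1"
      unfolding Au using c by (simp add: ac_simps)
    \<comment> \<open>The \<open>n_t\<close>- and \<open>n_w\<close>-coefficients obey one identity,
      with \<open>e\<close> standing for \<open>a p\<close> or \<open>b p\<close>.\<close>
    have rd: "r * (e * (c * u$1) + (e * d * u$1 + y / r)) = e * u$1 + y" for e y
    proof -
      have "r * (e * (c * u$1) + (e * d * u$1 + y / r)) = e * u$1 * (r * c + r * d) + y"
        using r_pos by (simp add: distrib_left distrib_right)
      then show ?thesis by (simp add: d)
    qed
    have A2: "r * (a p * (?A *v u) $ 1 + (?A *v u) $ 2) = a p * u$1 + u$2"
      and A3: "r * (b p * (?A *v u) $ 1 + (?A *v u) $ 3) = b p * u$1 + u$3"
      unfolding Au by (rule rd)+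
    show ?thesis
      by (simp add: frechet_tube_frame[OF p reg(1)] frechet_gauss_frame[OF p reg(1)] A1 A2 A3)
  qed
  show ?thesis
    unfolding shape_operator_def
  proof (rule the_equality)
    show "\<forall>v. frechet_derivative (tube \<beta> F r) (at p) (?A *v v) =
      - frechet_derivative (tube_gauss F) (at p) v" using A by blast
  next
    fix B :: "real^3^3"
    assume "\<forall>v. frechet_derivative (tube \<beta> F r) (at p) (B *v v) =
      - frechet_derivative (tube_gauss F) (at p) v"
    then have "B *v v = ?A *v v" for v
      using A inj by (metis injD)
    then show "B = ?A" by (simp add: matrix_eq)
  qed
qed

text \<open>Only the product of the principal curvatures enters, and the characteristic polynomial
  at 0 determines it, whichever ordering \<open>SOME\<close> selects.\<close>

lemma mean_curv_3_tube:
  assumes p: "p $ 1 \<in> I" and inj: "inj (frechet_derivative (tube \<beta> F r) (at p))"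
  shows "mean_curv (tube \<beta> F r) (tube_gauss F) 3 p = g p / (r\<^sup>2 * (1 + r * g p))"
proof -
  let ?S = "shape_operator (tube \<beta> F r) (tube_gauss F) p"
  let ?\<kappa> = "principal_curvatures (tube \<beta> F r) (tube_gauss F) p"
  note S = shape_operator_tube[OF p inj]
  have det: "det (mat x - ?S) = (x - g p / (1 + r * g p)) * (x - 1 / r) * (x - 1 / r)" for x
    unfolding S by (simp add: det_3 mat_def)
  \<comment> \<open>The diagonal of the triangular matrix is a witness for
    \<open>SOME\<close>.\<close>
  have "\<forall>x. det (mat x - ?S) =
      (\<Prod>i\<in>UNIV. x - (vector [g p / (1 + r * g p), 1 / r, 1 / r] :: real^3) $ i)"
    unfolding det by (simp only: prod_UNIV_3 vector_3) simp
  then have "\<forall>x. det (mat x - ?S) = (\<Prod>i\<in>UNIV. x - ?\<kappa> $ i)"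
    unfolding principal_curvatures_def by (rule someI)
  from this[rule_format, of 0]
  have \<kappa>: "(\<Prod>i\<in>UNIV. ?\<kappa> $ i) = g p / (1 + r * g p) * (1 / r) * (1 / r)"
    unfolding det by (simp add: prod_UNIV_3)
  \<comment> \<open>The sum over 3-element index sets has a single term.\<close>
  have "{J. J \<subseteq> (UNIV :: 3 set) \<and> card J = 3} = {UNIV}"
    using card_eq_UNIV_imp_eq_UNIV[of "_ :: 3 set"] by auto
  then show ?thesis
    by (simp add: mean_curv_def normal_sign_def lorentz_normal_normal[OF p] curv_coeff_def \<kappa>
        power2_eq_square)
qed

text \<open>The description of the gradient by \<open>THE\<close> is met by exactly one vector: the
  pulled-back metric is nondegenerate, so it maps parameter vectors injectively, hence by dimension
  onto, the linear functionals.\<close>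

lemma
  assumes p: "p $ 1 \<in> I" and inj: "inj (frechet_derivative (tube \<beta> F r) (at p))"
    and f: "f differentiable (at p)"
  shows surface_grad_tube_tangent:
      "surface_grad (tube \<beta> F r) f p \<in> range (frechet_derivative (tube \<beta> F r) (at p))"
    and lorentz_surface_grad_tube:
      "lorentz (surface_grad (tube \<beta> F r) f p) (frechet_derivative (tube \<beta> F r) (at p) u)
    = frechet_derivative f (at p) u"
proof -
  note reg = regular_point[OF p inj]
  define D where "D = frechet_derivative (tube \<beta> F r) (at p)"
  note D_frame = frechet_tube_frame[OF p reg(1), folded D_def]
  have lin: "linear D"
    unfolding D_def using tube_has_derivative[OF p]
    by (intro linear_frechet_derivative) (auto simp: differentiable_def)
  have lin_f: "linear (frechet_derivative f (at p))"
    by (rule linear_frechet_derivative[OF f])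
  have nondeg: "v = 0" if "\<And>u. lorentz (D v) (D u) = 0" for v
  proof -
    have e: "- ((v$1 * (1 + r * g p)) * (u$1 * (1 + r * g p)))
        + (r * (a p * v$1 + v$2)) * (r * (a p * u$1 + u$2)) * (cos (p$3))\<^sup>2
        + (r * (b p * v$1 + v$3)) * (r * (b p * u$1 + u$3)) = 0" for u :: "real^3"
      using that[of u] by (simp only: D_frame lorentz_tangent[OF p])
    \<comment> \<open>The test vector has only an \<open>F 1\<close>-part under \<open>D\<close>,
      which isolates the first coordinate; the t- and w-directions then isolate the others.\<close>
    have v1: "v $ 1 = 0" using e[of "vector [1, - a p, - b p]"] reg by simp
    have "v $ 2 = 0" using e[of "vector [0, 1, 0]"] reg r_pos v1 by simp
    moreover have "v $ 3 = 0" using e[of "vector [0, 0, 1]"] reg r_pos v1 by simp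
    ultimately show ?thesis using v1 by (simp add: vec_eq_iff forall_3)
  qed
  \<comment> \<open>\<open>B\<close> is the Gram matrix of the coordinate vector fields, acting on
    \<open>v\<close>; its value lists the functional \<open>lorentz (D v) (D u)\<close> on the
    standard basis.\<close>
  define B where "B v = (\<chi> i. lorentz (D v) (D (axis i 1)))" for v
  have lin_ext: "h u = h' u"
    if "linear h" "linear h'" "\<And>i. h (axis i 1) = h' (axis i 1)"
    for h h' :: "real^3 \<Rightarrow> real" and u
    by (rule linear_eq_stdbasis[THEN fun_cong, OF that(1,2)])
       (use that(3) in \<open>auto simp: Basis_vec_def\<close>)
  have lin_D: "linear (\<lambda>u. lorentz (D v) (D u))" for v
    by (rule linearI)
      (simp_all add: linear_add[OF lin] linear_scale[OF lin] lorentz_linear)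
  have lin_B: "linear B"
    by (rule linearI)
      (simp_all add: B_def vec_eq_iff linear_add[OF lin] linear_scale[OF lin] lorentz_linear)
  have "inj B"
  proof (rule linear_injective_0[OF lin_B, THEN iffD2], intro allI impI)
    fix v assume "B v = 0"
    then have "lorentz (D v) (D (axis i 1)) = 0" for i
      by (simp add: B_def vec_eq_iff)
    then have "lorentz (D v) (D u) = 0" for u
      using lin_ext[OF lin_D[of v] linear_zero, of u] by simp
    then show "v = 0" by (rule nondeg)
  qed
  then have "surj B" using lin_B linear_injective_imp_surjective by blast
  then obtain v where "(\<chi> i. frechet_derivative f (at p) (axis i 1)) = B v"
    by (metis surjD)
  then have "lorentz (D v) (D (axis i 1)) = frechet_derivative f (at p) (axis i 1)" for i
    by (simp add: B_def vec_eq_iff)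
  then have v: "lorentz (D v) (D u) = frechet_derivative f (at p) u" for u
    using lin_ext[OF lin_D[of v] lin_f, of u] by simp
  have "surface_grad (tube \<beta> F r) f p = D v"
    unfolding surface_grad_def D_def[symmetric]
  proof (rule the_equality)
    show "D v \<in> range D \<and> (\<forall>u. lorentz (D v) (D u) = frechet_derivative f (at p) u)"
      using v by blast
  next
    fix x assume "x \<in> range D \<and> (\<forall>u. lorentz x (D u) = frechet_derivative f (at p) u)"
    then obtain v' where v': "x = D v'" "\<And>u. lorentz (D v') (D u) = frechet_derivative f (at p) u"
      by blast
    have "v' - v = 0"
      by (rule nondeg) (simp add: linear_diff[OF lin] lorentz_linear v v'(2))
    then show "x = D v" using v'(1) by simp
  qed
  then show "surface_grad (tube \<beta> F r) f p \<in> range (frechet_derivative (tube \<beta> F r) (at p))"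
    and "lorentz (surface_grad (tube \<beta> F r) f p) (frechet_derivative (tube \<beta> F r) (at p) u)
      = frechet_derivative f (at p) u"
    using v by (simp_all add: D_def)
qed

text \<open>H_3 is a function of \<open>g\<close> alone, so the chain rule reduces its t-derivative,
  taken along \<open>axis 2 1\<close>, to that of \<open>g\<close>.\<close>

lemma mean_curv_3_tube_has_derivative:
  assumes U: "open U" "\<And>q. q \<in> U \<Longrightarrow> q $ 1 \<in> I"
      "\<And>q. q \<in> U \<Longrightarrow> inj (frechet_derivative (tube \<beta> F r) (at q))"
    and p: "p \<in> U"
  shows "\<exists>f'. (mean_curv (tube \<beta> F r) (tube_gauss F) 3 has_derivative f') (at p) \<and>
    f' (axis 2 1) = - (k1 (p$1) * sin (p$2) * cos (p$3)) / (r * (1 + r * g p))\<^sup>2"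
proof -
  have "k1 differentiable (at (p$1))"
    using frenet U(2)[OF p] smooth_on_imp_differentiable by (auto simp: timelike_frenet_curve_def)
  then obtain k' where "(k1 has_real_derivative k') (at (p$1))"
    by (auto simp: real_differentiable_def)
  note k = has_derivative_component_real[OF this]
  have nz: "1 + r * g p \<noteq> 0" using regular_point(2) U p by blast
  define g' where "g' u = u$1 * k' * cos (p$2) * cos (p$3)
      - k1 (p$1) * (u$2 * sin (p$2)) * cos (p$3) - k1 (p$1) * cos (p$2) * (u$3 * sin (p$3))"
    for u :: "real^3"
  have g: "(g has_derivative g') (at p)"
    unfolding g_def[abs_def]
    by (rule derivative_eq_intros has_derivative_vec_nth k refl)+ (simp add: fun_eq_iff g'_def algebra_simps)
  define L where "L = 1 + r * g p"
  have "((\<lambda>x. x / (r\<^sup>2 * (1 + r * x))) has_real_derivative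
      (1 * (r\<^sup>2 * L) - g p * (r\<^sup>2 * r)) / (r\<^sup>2 * L)\<^sup>2) (at (g p))"
    by (rule derivative_eq_intros refl)+
       (use nz r_pos in \<open>simp_all add: L_def power2_eq_square\<close>)
  \<comment> \<open>The numerator collapses to a nonzero constant, so critical points of H_3 are
    those of \<open>g\<close>.\<close>
  also have "1 * (r\<^sup>2 * L) - g p * (r\<^sup>2 * r) = r\<^sup>2"
    by (simp add: L_def algebra_simps)
  also have "r\<^sup>2 / (r\<^sup>2 * L)\<^sup>2 = 1 / (r * (1 + r * g p))\<^sup>2"
    using r_pos by (simp add: L_def[symmetric] power_mult_distrib power2_eq_square)
  finally have "((\<lambda>q. g q / (r\<^sup>2 * (1 + r * g q))) has_derivative
      (\<lambda>u. g' u / (r * (1 + r * g p))\<^sup>2)) (at p)"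
    using has_derivative_compose[OF g, of "\<lambda>x. x / (r\<^sup>2 * (1 + r * x))"]
    by (fastforce simp: has_field_derivative_def)
  \<comment> \<open>The closed form is known only on \<open>U\<close>; openness transfers the
    derivative.\<close>
  then have "(mean_curv (tube \<beta> F r) (tube_gauss F) 3 has_derivative
      (\<lambda>u. g' u / (r * (1 + r * g p))\<^sup>2)) (at p)"
    by (rule has_derivative_transform_within_open[OF _ U(1) p])
       (simp add: mean_curv_3_tube U)
  moreover have "g' (axis 2 1) = - (k1 (p$1) * sin (p$2) * cos (p$3))"
    by (simp add: g'_def axis_def)
  ultimately show ?thesis by fastforce
qed

end

section \<open>Vanishing of the first curvature and contradiction\<close>

lemma sin_not_locally_zero:
  fixes t :: real
  assumes "0 < e"
  obtains h where "\<bar>h\<bar> < e" "sin (t + h) \<noteq> 0"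
proof (cases "sin t = 0")
  case True
  \<comment> \<open>The bound 1 keeps \<open>h\<close> below pi, so that sin h is positive and sin
    (t + h) = cos t sin h is nonzero.\<close>
  define h where "h = min (e / 2) 1"
  have "0 < h" "h < pi" using assms pi_gt3 by (auto simp: h_def)
  then have "sin h > 0" by (rule sin_gt_zero)
  moreover have "cos t \<noteq> 0" using True sin_cos_squared_add[of t] by auto
  ultimately have "sin (t + h) \<noteq> 0" using True by (simp add: sin_add)
  moreover have "\<bar>h\<bar> < e" using assms by (auto simp: h_def)
  ultimately show ?thesis using that by blast
next
  case False
  then show ?thesis using that[of 0] assms by simp
qed

theorem theorem7:
  fixes I :: "real set" and \<beta> :: "real \<Rightarrow> real^4" and F :: "4 \<Rightarrow> real \<Rightarrow> real^4"
    and k1 k2 k3 :: "real \<Rightarrow> real" and r :: real and U :: "(real^3) set"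
  assumes "open I" and "is_interval I" and "I \<noteq> {}"
    and "timelike_frenet_curve I \<beta> F k1 k2 k3"
    and "r > 0"
    and "open U" and "connected U" and "(\<lambda>p. p $ 1) ` U = I"
    and "immersion_on U (tube \<beta> F r)"
  shows "\<not> first_kind_L2_pointwise_1_type U (tube \<beta> F r) (tube_gauss F)"
proof
  assume "first_kind_L2_pointwise_1_type U (tube \<beta> F r) (tube_gauss F)"
  then obtain m p where p: "p \<in> U" "m p \<noteq> 0"
    and m: "\<And>q. q \<in> U \<Longrightarrow> L2_gauss (tube \<beta> F r) (tube_gauss F) q = m q *\<^sub>R tube_gauss F q"
    unfolding first_kind_L2_pointwise_1_type_def by blast
  interpret tube_of_frenet_curve I \<beta> F k1 k2 k3 r
    by unfold_locales (use assms in auto)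
  let ?X = "tube \<beta> F r" and ?N = "tube_gauss F"
  let ?H = "mean_curv ?X ?N 3"
  have I: "q $ 1 \<in> I" if "q \<in> U" for q using assms(8) that by blast
  have inj: "inj (frechet_derivative ?X (at q))" if "q \<in> U" for q
    using assms(9) that by (simp add: immersion_on_def)
  have L2: "L2_gauss ?X ?N q =
      - (surface_grad ?X ?H q + (3 * mean_curv ?X ?N 1 q * ?H q) *\<^sub>R ?N q)" if "q \<in> U" for q
    by (simp add: L2_gauss_def normal_sign_def lorentz_normal_normal[OF I[OF that]])
  have diff: "?H differentiable (at q)" if "q \<in> U" for q
    using mean_curv_3_tube_has_derivative[OF assms(6) I inj that] by (auto simp: differentiable_def)
  have normal_tangent: "lorentz (?N q) (frechet_derivative ?X (at q) u) = 0" if q: "q \<in> U" for q u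
    using regular_point(1)[OF I[OF q] inj[OF q]]
    by (simp only: frechet_tube_frame[OF I[OF q]] lorentz_normal_tangent[OF I[OF q]] not_False_eq_True)
  \<comment> \<open>Solving the eigenvalue equation for the gradient shows that it is
    normal.\<close>
  have grad: "surface_grad ?X ?H q = - (m q + 3 * mean_curv ?X ?N 1 q * ?H q) *\<^sub>R ?N q"
    if q: "q \<in> U" for q
  proof -
    have "x = - (c + d) *\<^sub>R y" if "- (x + d *\<^sub>R y) = c *\<^sub>R y" for x y :: "real^4" and c d
    proof -
      have "x = - (- (x + d *\<^sub>R y)) - d *\<^sub>R y" by simp
      also have "\<dots> = - (c + d) *\<^sub>R y" unfolding that by (simp add: algebra_simps)
      finally show ?thesis .
    qed
    then show ?thesis using m[OF q] L2[OF q] by simp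
  qed
  \<comment> \<open>The differential pairs the gradient with tangent vectors, which are orthogonal
    to the normal.\<close>
  have dH: "frechet_derivative ?H (at q) u = 0" if q: "q \<in> U" for q u
    using lorentz_surface_grad_tube[OF I[OF q] inj[OF q] diff[OF q], of u]
    unfolding grad[OF q] lorentz_scaleR_left normal_tangent[OF q] by simp
  have k1_sin: "k1 (q$1) * sin (q$2) = 0" if q: "q \<in> U" for q
  proof -
    obtain f' where f': "(?H has_derivative f') (at q)"
      "f' (axis 2 1) = - (k1 (q$1) * sin (q$2) * cos (q$3)) / (r * (1 + r * g q))\<^sup>2"
      using mean_curv_3_tube_has_derivative[OF assms(6) I inj q] by blast
    have "f' (axis 2 1) = 0" using dH[OF q] frechet_derivative_at[OF f'(1)] by simp
    then show ?thesis
      using f'(2) regular_point[OF I[OF q] inj[OF q]] assms(5) by auto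
  qed
  have k1: "k1 (q$1) = 0" if q: "q \<in> U" for q
  proof -
    obtain e where e: "e > 0" "ball q e \<subseteq> U" using assms(6) q openE by blast
    obtain h where h: "\<bar>h\<bar> < e" "sin (q$2 + h) \<noteq> 0"
      using sin_not_locally_zero[OF e(1)] by blast
    \<comment> \<open>Moving in the t-direction keeps s, hence \<open>k1 (q$1)\<close>, while the
      sine becomes nonzero.\<close>
    have "q + axis 2 h \<in> U"
      using e(2) h(1) by (auto simp: dist_norm norm_eq_sqrt_inner inner_axis_axis)
    from k1_sin[OF this] show ?thesis using h(2) by (simp add: axis_def)
  qed
  have H: "?H p = 0"
    using mean_curv_3_tube[OF I inj] p(1) k1[OF p(1)] by (simp add: g_def)
  \<comment> \<open>With H_3 = 0 the gradient at \<open>p\<close> is \<open>- m p\<close> times the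
    normal. Being tangent as well, it is orthogonal to the unit normal, which forces
    \<open>m p = 0\<close>.\<close>
  obtain u where "surface_grad ?X ?H p = frechet_derivative ?X (at p) u"
    using surface_grad_tube_tangent[OF I inj diff] p(1) by blast
  then have "lorentz (?N p) (- m p *\<^sub>R ?N p) = 0"
    using grad[OF p(1)] normal_tangent[OF p(1), of u] H by simp
  then show False
    using p(2) lorentz_normal_normal[OF I[OF p(1)]] by (simp add: lorentz_linear)
qed

end
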